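(* Let $\mathbf{a}<\mathbf{b}$ be positive co-prime integers and $k$ a positive integer. For $n,m\in\mathbb{N}$ let $A_{nm}=\{\alpha k\mathbf{a}+\beta k\mathbf{b}\mid \alpha\in\{0,\dots,n\},\ \beta\in\{0,\dots,m\}\}$. Let $(n_1,m_1),\dots,(n_t,m_t)\in\mathbb{N}^2$ with $n_i+m_i>0$ for all $i$, let $b_1,\dots,b_p,a_1,\dots,a_s$ be positive integers with $s\le t$, and let $S$ be the sumset semigroup generated by the list $$\{b_1\},\dots,\{b_p\},\ \{a_1\}+A_{n_1m_1},\dots,\{a_s\}+A_{n_sm_s},\ A_{n_{s+1}m_{s+1}},\dots,A_{n_tm_t},$$ with ideal $I_S\subset\mathbf{k}[x_1,\dots,x_p,z_1,\dots,z_t]$, where $x_j$ corresponds to $\{b_j\}$, $z_i$ to $\{a_i\}+A_{n_im_i}$ for $i\le s$, and $z_i$ to $A_{n_im_i}$ for $i>s$. Let $S'$ be the sumset semigroup generated by $\{b_1\},\dots,\{b_p\},\{a_1\},\dots,\{a_s\},\{0,k\mathbf{a}\},\{0,k\mathbf{b}\}$, with ideal $I_{S'}\subset\mathbf{k}[x_1,\dots,x_p,w_1,\dots,w_s,x,y]$, where $x_j$ corresponds to $\{b_j\}$, $w_i$ to $\{a_i\}$, $x$ to $\{0,k\mathbf{a}\}$ and $y$ to $\{0,k\mathbf{b}\}$. Then, in $\mathbf{k}[x_1,\dots,x_p,w_1,\dots,w_s,x,y,z_1,\dots,z_t]$, $$I_S=\Big(I_{S'}+\big\langle z_1-w_1x^{n_1}y^{m_1},\dots,z_s-w_sx^{n_s}y^{m_s},\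 z_{s+1}-x^{n_{s+1}}y^{m_{s+1}},\dots,z_t-x^{n_t}y^{m_t}\big\rangle\Big)\cap\mathbf{k}[x_1,\dots,x_p,z_1,\dots,z_t].$$
   Context: $\mathrm{FS}(\mathbb{N})$ is the monoid of finite non-empty subsets of $\mathbb{N}$ under $A+B=\{a+b\mid a\in A,b\in B\}$ with identity $\{0\}$; $\alpha\otimes A$ is the $\alpha$-fold sum of $A$ ($0\otimes A=\{0\}$). A sumset semigroup is a finitely generated submonoid of $\mathrm{FS}(\mathbb{N})$. For a field $\mathbf{k}$ and a list of generators $A_1,\dots,A_r$ of a sumset semigroup $S$, with variables $u_1,\dots,u_r$ assigned to them, the ideal $I_S\subset\mathbf{k}[u_1,\dots,u_r]$ is the binomial ideal generated by all $u_1^{\alpha_1}\cdots u_r^{\alpha_r}-u_1^{\beta_1}\cdots u_r^{\beta_r}$ with $\sum_i\alpha_i\otimes A_i=\sum_i\beta_i\otimes A_i$. *)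

theory Defs
  imports "HOL-Algebra.Ideal" "HOL-Library.Poly_Mapping" "HOL-Library.Set_Algebras"
begin

text \<open>
  Addition of subsets of \<open>\<nat>\<close> is the Minkowski sum of \<^theory>\<open>HOL-Library.Set_Algebras\<close>, for which
  sets form a commutative monoid with zero element \<open>{0}\<close>.
\<close>

definition FS :: "nat set set"
  where "FS = {A. finite A \<and> A \<noteq> {}}"

definition nfold_sumset :: "nat \<Rightarrow> nat set \<Rightarrow> nat set"
  where "nfold_sumset \<alpha> A = (\<Sum>i<\<alpha>. A)"

lemma nfold_sumset_0: "nfold_sumset 0 A = {0}"
  by (simp add: nfold_sumset_def)

lemma nfold_sumset_Suc: "nfold_sumset (Suc \<alpha>) A = nfold_sumset \<alpha> A + A"
  by (simp add: nfold_sumset_def)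

lemma FS_zero: "{0} \<in> FS"
  by (simp add: FS_def)

lemma FS_plus: "A \<in> FS \<Longrightarrow> B \<in> FS \<Longrightarrow> A + B \<in> FS"
  by (auto simp: FS_def set_plus_def finite_image_set2)

lemma FS_sum: "(\<And>v. v \<in> V \<Longrightarrow> A v \<in> FS) \<Longrightarrow> (\<Sum>v\<in>V. A v) \<in> FS"
  by (induction V rule: infinite_finite_induct) (auto simp: FS_zero FS_plus)

text \<open>
  A polynomial maps exponent vectors (finitely supported functions from variables to \<open>\<nat>\<close>) to
  coefficients, with finite support; multiplication is convolution. The polynomials over all
  variables of type \<open>'v\<close> contain \<open>k[V]\<close> for every set \<open>V\<close> of variables as a subring.
\<close>

type_synonym ('v, 'k) poly = "('v \<Rightarrow>\<^sub>0 nat) \<Rightarrow>\<^sub>0 'k"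

definition Mon :: "('v \<Rightarrow>\<^sub>0 nat) \<Rightarrow> ('v, 'k::field) poly"
  where "Mon e = Poly_Mapping.single e 1"

definition Var :: "'v \<Rightarrow> ('v, 'k::field) poly"
  where "Var v = Mon (Poly_Mapping.single v 1)"

definition exponents_in :: "'v set \<Rightarrow> ('v \<Rightarrow>\<^sub>0 nat) set"
  where "exponents_in V = {e. Poly_Mapping.keys e \<subseteq> V}"

definition polys_in :: "'v set \<Rightarrow> ('v, 'k::field) poly set"
  where "polys_in V = {f. Poly_Mapping.keys f \<subseteq> exponents_in V}"

definition poly_ring :: "'v set \<Rightarrow> ('v, 'k::field) poly ring"
  where "poly_ring V =
    \<lparr>carrier = polys_in V, mult = (*), one = 1, zero = 0, add = (+)\<rparr>"

lemma polys_in_mult: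
  assumes "f \<in> polys_in V" "g \<in> polys_in V"
  shows "f * g \<in> polys_in V"
proof -
  have "Poly_Mapping.keys (f * g) \<subseteq> exponents_in V"
  proof
    fix e assume "e \<in> Poly_Mapping.keys (f * g)"
    then obtain c d where "e = c + d" "c \<in> Poly_Mapping.keys f" "d \<in> Poly_Mapping.keys g"
      using keys_mult[of f g] by blast
    then show "e \<in> exponents_in V"
      using assms Poly_Mapping.keys_add[of c d] unfolding polys_in_def exponents_in_def by blast
  qed
  then show ?thesis by (simp add: polys_in_def)
qed

lemma polys_in_add: "f \<in> polys_in V \<Longrightarrow> g \<in> polys_in V \<Longrightarrow> f + g \<in> polys_in V"
  using Poly_Mapping.keys_add[of f g] by (auto simp: polys_in_def)

lemma cring_poly_ring: "cring (poly_ring V :: ('v, 'k::field) poly ring)"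
proof (rule cringI)
  show "abelian_group (poly_ring V :: ('v, 'k) poly ring)"
  proof (rule abelian_groupI)
    fix f assume "f \<in> carrier (poly_ring V :: ('v, 'k) poly ring)"
    then show "\<exists>g\<in>carrier (poly_ring V :: ('v, 'k) poly ring). g \<oplus>\<^bsub>poly_ring V\<^esub> f = \<zero>\<^bsub>poly_ring V\<^esub>"
      by (intro bexI[of _ "- f"]) (auto simp: poly_ring_def polys_in_def)
  qed (auto simp: poly_ring_def polys_in_add algebra_simps, auto simp: polys_in_def)
  show "Group.comm_monoid (poly_ring V :: ('v, 'k) poly ring)"
    by (rule Group.comm_monoidI)
       (auto simp: poly_ring_def polys_in_mult algebra_simps,
        auto simp: polys_in_def exponents_in_def)
qed (simp_all add: poly_ring_def algebra_simps)

text \<open>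
  The ideal of \<open>k[V]\<close> attached to the sumset semigroup generated by the sets \<open>A v\<close> with \<open>v \<in> V\<close>,
  where \<open>V\<close> is finite and the variable \<open>v\<close> corresponds to \<open>A v\<close>.
\<close>

definition sumset_eval :: "'v set \<Rightarrow> ('v \<Rightarrow> nat set) \<Rightarrow> ('v \<Rightarrow>\<^sub>0 nat) \<Rightarrow> nat set"
  where "sumset_eval V A \<alpha> = (\<Sum>v\<in>V. nfold_sumset (Poly_Mapping.lookup \<alpha> v) (A v))"

definition sumset_ideal :: "'v set \<Rightarrow> ('v \<Rightarrow> nat set) \<Rightarrow> ('v, 'k::field) poly set"
  where "sumset_ideal V A =
    Idl\<^bsub>poly_ring V\<^esub> {Mon \<alpha> - Mon \<beta> | \<alpha> \<beta>.
      \<alpha> \<in> exponents_in V \<and> \<beta> \<in> exponents_in V \<and> sumset_eval V A \<alpha> = sumset_eval V A \<beta>}"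

lemma sumset_eval_FS:
  assumes "\<And>v. v \<in> V \<Longrightarrow> A v \<in> FS"
  shows "sumset_eval V A \<alpha> \<in> FS"
  using assms by (auto simp: sumset_eval_def nfold_sumset_def intro!: FS_sum)

definition grid :: "nat \<Rightarrow> nat \<Rightarrow> nat \<Rightarrow> nat \<Rightarrow> nat \<Rightarrow> nat set"
  where "grid k \<aa> \<bb> n m = {\<alpha> * k * \<aa> + \<beta> * k * \<bb> | \<alpha> \<beta>. \<alpha> \<in> {0..n} \<and> \<beta> \<in> {0..m}}"

text \<open>The variables \<open>x\<^sub>j\<close>, \<open>w\<^sub>i\<close>, \<open>x\<close>, \<open>y\<close>, \<open>z\<^sub>i\<close>; indices start at 1.\<close>

datatype var = Xs nat | Ws nat | X | Y | Zs nat

text \<open>The generator corresponding to each variable, for both semigroups at once.\<close>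

primrec generator ::
  "nat \<Rightarrow> nat \<Rightarrow> nat \<Rightarrow> (nat \<Rightarrow> nat) \<Rightarrow> (nat \<Rightarrow> nat) \<Rightarrow> nat \<Rightarrow> (nat \<Rightarrow> nat) \<Rightarrow> (nat \<Rightarrow> nat) \<Rightarrow> var \<Rightarrow> nat set"
  where
    "generator k \<aa> \<bb> b a s n m (Xs j) = {b j}"
  | "generator k \<aa> \<bb> b a s n m (Ws i) = {a i}"
  | "generator k \<aa> \<bb> b a s n m X = {0, k * \<aa>}"
  | "generator k \<aa> \<bb> b a s n m Y = {0, k * \<bb>}"
  | "generator k \<aa> \<bb> b a s n m (Zs i) =
      (if i \<le> s then {a i} + grid k \<aa> \<bb> (n i) (m i) else grid k \<aa> \<bb> (n i) (m i))"

lemma generator_FS: "generator k \<aa> \<bb> b a s n m v \<in> FS"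
proof -
  have "grid k \<aa> \<bb> (n i) (m i) \<in> FS" for i
    by (auto simp: grid_def FS_def intro!: finite_image_set2)
  moreover have "{c} \<in> FS" "{c, d} \<in> FS" for c d
    by (simp_all add: FS_def)
  ultimately show ?thesis by (cases v) (auto intro: FS_plus)
qed

end

theory Submission
  imports Defs
begin

text \<open>
  Sending each monomial to the set it evaluates to defines a ring homomorphism from the polynomials
  to the monoid algebra of the sets under Minkowski sum, and \<open>I\<^sub>S\<close> is its kernel on the polynomials
  in the variables of \<open>S\<close>. Since \<open>A\<^sub>n\<^sub>m\<close> is the sum of \<open>n\<close> copies of \<open>{0, ka}\<close> and \<open>m\<close> copies of
  \<open>{0, kb}\<close>, the relations defining the \<open>z\<^sub>i\<close> lie in the kernel, so the right-hand side does too.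
  Conversely, modulo these relations a polynomial in the kernel is congruent to one without any
  \<open>z\<^sub>i\<close>, which still lies in the kernel and hence in \<open>I\<^sub>S\<^sub>'\<close>.
\<close>

section \<open>Finitely supported functions and linear extension of maps on their indices\<close>

lemma poly_mapping_eq_sum_single:
  fixes f :: "'a \<Rightarrow>\<^sub>0 'b::comm_monoid_add"
  shows "f = (\<Sum>e\<in>Poly_Mapping.keys f. Poly_Mapping.single e (Poly_Mapping.lookup f e))"
  by (rule poly_mapping_eqI)
    (auto simp: lookup_sum lookup_single when_def sum.delta in_keys_iff)

text \<open>Every finitely supported function is a finite sum of singletons. The rule serves both
  for polynomials and, one level down, for exponent vectors.\<close>

lemma poly_mapping_single_add_induct [case_names zero single add]:
  fixes f :: "'a \<Rightarrow>\<^sub>0 'b::comm_monoid_add"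
  assumes "P 0" and single: "\<And>e c. P (Poly_Mapping.single e c)"
    and "\<And>f g. P f \<Longrightarrow> P g \<Longrightarrow> P (f + g)"
  shows "P f"
proof -
  have "P (\<Sum>e\<in>K. Poly_Mapping.single e (Poly_Mapping.lookup f e))" for K
    using assms by (induction K rule: infinite_finite_induct) auto
  from this[of "Poly_Mapping.keys f"] show ?thesis
    by (simp flip: poly_mapping_eq_sum_single)
qed

text \<open>The linear extension of \<open>E\<close> to formal combinations: coefficients over one
  fibre of \<open>E\<close> add up. It is applied both to evaluations into sets and to rewritings of
  exponents.\<close>

definition pushforward :: "('a \<Rightarrow> 'b) \<Rightarrow> ('a \<Rightarrow>\<^sub>0 'k) \<Rightarrow> ('b \<Rightarrow>\<^sub>0 'k::comm_monoid_add)"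
  where "pushforward E f =
    (\<Sum>e\<in>Poly_Mapping.keys f. Poly_Mapping.single (E e) (Poly_Mapping.lookup f e))"

text \<open>Indices outside the support contribute zero terms. This allows \<open>f\<close>,
  \<open>g\<close> and \<open>f + g\<close> to be summed over one common index set although
  cancellation may shrink the support of the sum.\<close>

lemma pushforward_superset:
  assumes "finite K" "Poly_Mapping.keys f \<subseteq> K"
  shows "pushforward E f = (\<Sum>e\<in>K. Poly_Mapping.single (E e) (Poly_Mapping.lookup f e))"
  unfolding pushforward_def using assms
  by (intro sum.mono_neutral_left) (auto simp: in_keys_iff)

lemma pushforward_0 [simp]: "pushforward E 0 = 0"
  by (simp add: pushforward_def)

lemma pushforward_single [simp]:
  "pushforward E (Poly_Mapping.single e c) = Poly_Mapping.single (E e) c"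
  by (subst pushforward_superset[where K = "{e}"]) auto

lemma pushforward_add: "pushforward E (f + g) = pushforward E f + pushforward E g"
proof -
  let ?K = "Poly_Mapping.keys f \<union> Poly_Mapping.keys g"
  have "Poly_Mapping.keys (f + g) \<subseteq> ?K"
    by (rule Poly_Mapping.keys_add)
  then show ?thesis
    by (simp add: pushforward_superset[where K = ?K] lookup_add single_add sum.distrib)
qed

lemma pushforward_uminus:
  fixes f :: "'a \<Rightarrow>\<^sub>0 'k::ab_group_add"
  shows "pushforward E (- f) = - pushforward E f"
  using pushforward_add[of E f "- f"] by (simp add: eq_neg_iff_add_eq_0 add.commute)

lemma pushforward_diff:
  fixes f :: "'a \<Rightarrow>\<^sub>0 'k::ab_group_add"
  shows "pushforward E (f - g) = pushforward E f - pushforward E g"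
  using pushforward_add[of E f "- g"] by (simp add: pushforward_uminus)

lemma pushforward_sum: "pushforward E (\<Sum>i\<in>I. f i) = (\<Sum>i\<in>I. pushforward E (f i))"
  by (induction I rule: infinite_finite_induct) (simp_all add: pushforward_add)

text \<open>Term by term comparison: if moving each single term along \<open>F\<close> is a
  congruence modulo an ideal, then so is moving all of \<open>f\<close>.\<close>

lemma diff_pushforward:
  fixes f :: "'a \<Rightarrow>\<^sub>0 'k::ab_group_add"
  shows "f - pushforward F f = (\<Sum>e\<in>Poly_Mapping.keys f.
    Poly_Mapping.single e (Poly_Mapping.lookup f e) -
    Poly_Mapping.single (F e) (Poly_Mapping.lookup f e))"
  unfolding sum_subtractf pushforward_def by (simp flip: poly_mapping_eq_sum_single)

text \<open>Both sides are biadditive in \<open>f\<close> and \<open>g\<close>, so it suffices to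
  compare them on single terms, where multiplication adds the indices and \<open>E\<close> respects
  that addition.\<close>

lemma pushforward_mult:
  fixes E :: "'a::comm_monoid_add \<Rightarrow> 'b::comm_monoid_add" and f g :: "'a \<Rightarrow>\<^sub>0 'k::comm_semiring_1"
  assumes E: "\<And>d e. E (d + e) = E d + E e"
  shows "pushforward E (f * g) = pushforward E f * pushforward E g"
proof (induction f rule: poly_mapping_single_add_induct)
  case (single d c)
  show ?case
    by (induction g rule: poly_mapping_single_add_induct)
      (simp_all add: mult_single E distrib_left pushforward_add)
qed (simp_all add: distrib_right pushforward_add)

lemma pushforward_cong:
  assumes "\<And>e. e \<in> Poly_Mapping.keys f \<Longrightarrow> E e = E' e"
  shows "pushforward E f = pushforward E' f"
  unfolding pushforward_def using assms by (intro sum.cong) auto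

lemma pushforward_pushforward: "pushforward E (pushforward F f) = pushforward (\<lambda>e. E (F e)) f"
  by (simp add: pushforward_def[of F] pushforward_sum) (simp add: pushforward_def)

section \<open>Evaluation of exponent vectors as sumsets\<close>

lemma nfold_sumset_add: "nfold_sumset (i + j) A = nfold_sumset i A + nfold_sumset j A"
  by (induction j) (simp_all add: nfold_sumset_0 nfold_sumset_Suc add.assoc flip: set_zero)

lemma sumset_eval_0 [simp]: "sumset_eval V A 0 = 0"
  by (simp add: sumset_eval_def nfold_sumset_0 flip: set_zero)

lemma sumset_eval_add: "sumset_eval V A (d + e) = sumset_eval V A d + sumset_eval V A e"
  by (simp add: sumset_eval_def lookup_add nfold_sumset_add sum.distrib)

lemma sumset_eval_single:
  assumes "finite V" "v \<in> V"
  shows "sumset_eval V A (Poly_Mapping.single v j) = nfold_sumset j (A v)"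
proof -
  have "sumset_eval V A (Poly_Mapping.single v j) =
      (\<Sum>u\<in>V. if u = v then nfold_sumset j (A v) else 0)"
    unfolding sumset_eval_def
    by (intro sum.cong) (auto simp: lookup_single when_def nfold_sumset_0 simp flip: set_zero)
  then show ?thesis
    using assms by simp
qed

text \<open>A variable with exponent 0 contributes \<open>{0}\<close>, the neutral element. Hence
  one evaluation on a large set of variables serves for all its subsets.\<close>

lemma sumset_eval_superset:
  assumes "finite W" "V \<subseteq> W" "e \<in> exponents_in V"
  shows "sumset_eval V A e = sumset_eval W A e"
proof -
  have "nfold_sumset (Poly_Mapping.lookup e v) (A v) = 0" if "v \<in> W - V" for v
  proof -
    have "Poly_Mapping.lookup e v = 0"
      using that assms(3) by (auto simp: exponents_in_def in_keys_iff)
    then show ?thesis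
      by (simp add: nfold_sumset_0 flip: set_zero)
  qed
  then show ?thesis
    unfolding sumset_eval_def using assms(1,2) by (intro sum.mono_neutral_left) auto
qed

section \<open>Polynomials in a given set of variables, and monomials\<close>

lemma exponents_in_0 [simp]: "0 \<in> exponents_in V"
  by (simp add: exponents_in_def)

lemma exponents_in_single: "v \<in> V \<Longrightarrow> Poly_Mapping.single v j \<in> exponents_in V"
  by (simp add: exponents_in_def)

lemma exponents_in_add: "d \<in> exponents_in V \<Longrightarrow> e \<in> exponents_in V \<Longrightarrow> d + e \<in> exponents_in V"
  using Poly_Mapping.keys_add[of d e] by (auto simp: exponents_in_def)

lemma polys_in_single: "e \<in> exponents_in V \<Longrightarrow> Poly_Mapping.single e c \<in> polys_in V"
  by (simp add: polys_in_def)

lemma polys_in_0 [simp]: "0 \<in> polys_in V"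
  by (simp add: polys_in_def)

lemma polys_in_uminus: "f \<in> polys_in V \<Longrightarrow> - f \<in> polys_in V"
  by (simp add: polys_in_def)

lemma polys_in_diff: "f \<in> polys_in V \<Longrightarrow> g \<in> polys_in V \<Longrightarrow> f - g \<in> polys_in V"
  using polys_in_add[of f V "- g"] by (simp add: polys_in_uminus)

lemma polys_in_Mon: "e \<in> exponents_in V \<Longrightarrow> Mon e \<in> polys_in V"
  by (simp add: Mon_def polys_in_single)

lemma polys_in_1 [simp]: "1 \<in> polys_in V"
  by (simp add: polys_in_def)

lemma polys_in_mono: "V \<subseteq> W \<Longrightarrow> polys_in V \<subseteq> polys_in W"
  by (auto simp: polys_in_def exponents_in_def)

lemma polys_in_keys: "f \<in> polys_in V \<Longrightarrow> e \<in> Poly_Mapping.keys f \<Longrightarrow> e \<in> exponents_in V"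
  by (auto simp: polys_in_def)

lemma polys_in_sum: "(\<And>i. i \<in> I \<Longrightarrow> f i \<in> polys_in V) \<Longrightarrow> (\<Sum>i\<in>I. f i) \<in> polys_in V"
  by (induction I rule: infinite_finite_induct) (auto simp: polys_in_add)

lemma polys_in_pushforward:
  assumes "\<And>e. e \<in> Poly_Mapping.keys f \<Longrightarrow> F e \<in> exponents_in V"
  shows "pushforward F f \<in> polys_in V"
  unfolding pushforward_def using assms by (intro polys_in_sum polys_in_single)

lemma Mon_0 [simp]: "Mon 0 = 1"
  by (simp add: Mon_def)

lemma Mon_add: "Mon (d + e) = Mon d * Mon e"
  by (simp add: Mon_def mult_single)

lemma Var_power: "Var v ^ j = Mon (Poly_Mapping.single v j)"
  by (induction j) (simp_all add: Var_def flip: Mon_add single_add)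

lemma pushforward_Mon: "pushforward E (Mon e) = Poly_Mapping.single (E e) 1"
  by (simp add: Mon_def)

section \<open>Ideals of the polynomial rings\<close>

lemma poly_ring_ideal_closed:
  fixes I :: "('v, 'k::field) poly set"
  assumes "ideal I (poly_ring V)"
  shows poly_ring_ideal_0: "0 \<in> I"
    and poly_ring_ideal_add: "\<And>f g. f \<in> I \<Longrightarrow> g \<in> I \<Longrightarrow> f + g \<in> I"
    and poly_ring_ideal_mult: "\<And>f g. f \<in> I \<Longrightarrow> g \<in> polys_in V \<Longrightarrow> g * f \<in> I"
proof -
  interpret ideal I "poly_ring V" by fact
  show "0 \<in> I"
    using additive_subgroup.zero_closed[OF is_additive_subgroup] by (simp add: poly_ring_def)
  show "f + g \<in> I" if "f \<in> I" "g \<in> I" for f g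
    using additive_subgroup.a_closed[OF is_additive_subgroup that] by (simp add: poly_ring_def)
  show "g * f \<in> I" if "f \<in> I" "g \<in> polys_in V" for f g
    using I_l_closed[OF that(1), of g] that(2) by (simp add: poly_ring_def)
qed

lemma poly_ring_ideal_sum:
  assumes "ideal I (poly_ring V)" "\<And>i. i \<in> K \<Longrightarrow> f i \<in> I"
  shows "(\<Sum>i\<in>K. f i) \<in> I"
  using assms(2)
  by (induction K rule: infinite_finite_induct)
    (auto simp: poly_ring_ideal_0[OF assms(1)] poly_ring_ideal_add[OF assms(1)])

lemma poly_ring_genideal:
  assumes "G \<subseteq> polys_in V"
  shows ideal_genideal_poly_ring: "ideal (Idl\<^bsub>poly_ring V\<^esub> G) (poly_ring V)"
    and subset_genideal_poly_ring: "G \<subseteq> Idl\<^bsub>poly_ring V\<^esub> G"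
    and genideal_poly_ring_minimal: "\<And>I. ideal I (poly_ring V) \<Longrightarrow> G \<subseteq> I \<Longrightarrow> Idl\<^bsub>poly_ring V\<^esub> G \<subseteq> I"
proof -
  interpret cring "poly_ring V :: ('a, 'b) poly ring" by (rule cring_poly_ring)
  have G: "G \<subseteq> carrier (poly_ring V)"
    using assms by (simp add: poly_ring_def)
  show "ideal (Idl\<^bsub>poly_ring V\<^esub> G) (poly_ring V)"
    by (rule genideal_ideal[OF G])
  show "G \<subseteq> Idl\<^bsub>poly_ring V\<^esub> G"
    by (rule genideal_self[OF G])
  show "Idl\<^bsub>poly_ring V\<^esub> G \<subseteq> I" if "ideal I (poly_ring V)" "G \<subseteq> I" for I
    by (rule genideal_minimal[OF that])
qed

lemma ideal_poly_ringI:
  fixes I :: "('v, 'k::field) poly set"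
  assumes "I \<subseteq> polys_in V" "0 \<in> I" and add: "\<And>f g. f \<in> I \<Longrightarrow> g \<in> I \<Longrightarrow> f + g \<in> I"
    and mult: "\<And>f g. f \<in> I \<Longrightarrow> g \<in> polys_in V \<Longrightarrow> g * f \<in> I"
  shows "ideal I (poly_ring V)"
proof -
  interpret cring "poly_ring V :: ('v, 'k) poly ring" by (rule cring_poly_ring)
  \<comment> \<open>Negation is multiplication by the constant polynomial \<open>- 1\<close>, so
    absorption already gives closure under inverses.\<close>
  have uminus: "- f \<in> I" if "f \<in> I" for f
    using mult[OF that, of "- 1"] by (simp add: polys_in_uminus)
  have a_inv: "\<ominus>\<^bsub>poly_ring V\<^esub> f = - f" if "f \<in> I" for f
    using that uminus assms(1) by (intro minus_equality) (auto simp: poly_ring_def)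
  show ?thesis
  proof (rule idealI)
    show "subgroup I (add_monoid (poly_ring V))"
    proof (rule subgroup.intro)
      show "inv\<^bsub>add_monoid (poly_ring V)\<^esub> f \<in> I" if "f \<in> I" for f
        using that a_inv uminus by (simp add: a_inv_def)
    qed (use assms in \<open>auto simp: poly_ring_def\<close>)
    show "ring (poly_ring V :: ('v, 'k) poly ring)"
      by (rule ring_axioms)
  qed (use mult in \<open>auto simp: poly_ring_def mult.commute\<close>)
qed

section \<open>Sumset ideals as kernels, and elimination of variables\<close>

lemma ideal_pushforward_kernel:
  fixes E :: "('v \<Rightarrow>\<^sub>0 nat) \<Rightarrow> 'b::comm_monoid_add"
  assumes "\<And>d e. E (d + e) = E d + E e"
  shows "ideal {f \<in> polys_in V. pushforward E f = (0 :: 'b \<Rightarrow>\<^sub>0 'k::field)} (poly_ring V)"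
  by (rule ideal_poly_ringI)
    (auto simp: polys_in_add polys_in_mult pushforward_add pushforward_mult[OF assms])

text \<open>The generating binomials are killed because their two monomials have the same value.
  Conversely, modulo these binomials every monomial may be replaced by a fixed representative of its
  value; after that the coefficients collected at each representative are those of the image of
  \<open>f\<close>, which are zero.\<close>

lemma sumset_ideal_eq_kernel:
  "sumset_ideal V A = {f \<in> polys_in V. pushforward (sumset_eval V A) f = (0 :: _ \<Rightarrow>\<^sub>0 'k::field)}"
proof -
  define E where "E = sumset_eval V A"
  define G :: "('a, 'k) poly set" where
    "G = {Mon \<alpha> - Mon \<beta> | \<alpha> \<beta>. \<alpha> \<in> exponents_in V \<and> \<beta> \<in> exponents_in V \<and> E \<alpha> = E \<beta>}"
  have G: "G \<subseteq> polys_in V"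
    by (auto simp: G_def polys_in_Mon intro!: polys_in_diff)
  define I where "I = Idl\<^bsub>poly_ring V\<^esub> G"
  have I: "ideal I (poly_ring V)"
    unfolding I_def by (rule ideal_genideal_poly_ring[OF G])
  have "I \<subseteq> {f \<in> polys_in V. pushforward E f = 0}"
    unfolding I_def using G
    by (intro genideal_poly_ring_minimal ideal_pushforward_kernel)
      (auto simp: E_def sumset_eval_add G_def pushforward_diff pushforward_Mon)
  moreover have "f \<in> I" if f: "f \<in> polys_in V" "pushforward E f = 0" for f
  proof -
    \<comment> \<open>\<open>r\<close> picks one exponent vector over \<open>V\<close> in each fibre
      of the evaluation; at sets that are not values its result is arbitrary.\<close>
    define r where "r c = (SOME e. e \<in> exponents_in V \<and> E e = c)" for c
    have r: "r (E e) \<in> exponents_in V \<and> E (r (E e)) = E e" if "e \<in> exponents_in V" for e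
      unfolding r_def by (rule someI[of _ e]) (use that in simp)
    let ?c = "Poly_Mapping.lookup f"
    have *: "Poly_Mapping.single e (?c e) - Poly_Mapping.single (r (E e)) (?c e) \<in> I"
      if "e \<in> Poly_Mapping.keys f" for e
    proof -
      have e: "e \<in> exponents_in V"
        using polys_in_keys f(1) that by blast
      then have "Mon e - Mon (r (E e)) \<in> I"
        using subset_genideal_poly_ring[OF G] r[OF e] unfolding I_def G_def by fastforce
      \<comment> \<open>The multiplier is the coefficient of \<open>e\<close>, viewed as a constant
        polynomial.\<close>
      from poly_ring_ideal_mult[OF I this, of "Poly_Mapping.single 0 (?c e)"]
      show ?thesis
        by (simp add: polys_in_single Mon_def right_diff_distrib mult_single)
    qed
    \<comment> \<open>Replacing monomials by representatives factors through \<open>E\<close>, so it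
      sends \<open>f\<close> to 0; \<open>f\<close> is then the sum of its termwise differences,
      each of which lies in \<open>I\<close>.\<close>
    have "pushforward (\<lambda>e. r (E e)) f = pushforward r (pushforward E f)"
      by (simp add: pushforward_pushforward)
    also have "\<dots> = 0"
      by (simp add: f(2))
    finally have "f = f - pushforward (\<lambda>e. r (E e)) f"
      by simp
    also have "\<dots> = (\<Sum>e\<in>Poly_Mapping.keys f.
        Poly_Mapping.single e (?c e) - Poly_Mapping.single (r (E e)) (?c e))"
      by (rule diff_pushforward)
    also have "\<dots> \<in> I"
      using * by (intro poly_ring_ideal_sum[OF I])
    finally show ?thesis .
  qed
  ultimately show ?thesis
    unfolding sumset_ideal_def I_def G_def E_def by blast
qed

text \<open>The elimination argument in general form: all it uses about the sets attached to
  \<open>Z\<close> is that each is the value of a monomial \<open>q z\<close> over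
  \<open>V'\<close>. The sets \<open>V\<close> and \<open>V'\<close> may overlap, as they do in the
  application, where they share the variables \<open>Xs j\<close>.\<close>

lemma sumset_ideal_elimination:
  fixes A :: "'v \<Rightarrow> nat set" and V V' Z :: "'v set"
  defines "W \<equiv> V' \<union> Z"
  assumes fin: "finite W" and V: "V \<subseteq> W"
    and q: "\<And>z. z \<in> Z \<Longrightarrow> q z \<in> exponents_in V'"
    and A: "\<And>z. z \<in> Z \<Longrightarrow> A z = sumset_eval V' A (q z)"
  shows "(sumset_ideal V A :: ('v, 'k::field) poly set) =
    (Idl\<^bsub>poly_ring W\<^esub> (sumset_ideal V' A) <+>\<^bsub>poly_ring W\<^esub>
     Idl\<^bsub>poly_ring W\<^esub> ((\<lambda>z. Var z - Mon (q z)) ` Z)) \<inter> polys_in V"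
    (is "_ = (?I <+>\<^bsub>?R\<^esub> ?J) \<inter> _")
proof -
  define E where "E = sumset_eval W A"
  have E_add: "E (d + e) = E d + E e" for d e
    by (simp add: E_def sumset_eval_add)
  have V': "V' \<subseteq> W" and Z: "Z \<subseteq> W"
    by (auto simp: W_def)
  \<comment> \<open>The single evaluation \<open>E\<close> on \<open>W\<close> describes the ideals
    of both semigroups, which makes them comparable inside one ring.\<close>
  have ker: "sumset_ideal U A = {f \<in> polys_in U. pushforward E f = (0 :: _ \<Rightarrow>\<^sub>0 'k)}"
    if U: "U \<subseteq> W" for U
  proof -
    have "pushforward (sumset_eval U A) f = pushforward E f" if "f \<in> polys_in U"
      for f :: "('v, 'k) poly"
      using polys_in_keys[OF that] sumset_eval_superset[OF fin U]
      unfolding E_def by (intro pushforward_cong) auto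
    then show ?thesis
      by (auto simp: sumset_ideal_eq_kernel)
  qed
  have qW: "q z \<in> exponents_in W" if "z \<in> Z" for z
    using q[OF that] V' by (auto simp: exponents_in_def)
  have E_q: "E (q z) = E (Poly_Mapping.single z 1)" if z: "z \<in> Z" for z
  proof -
    have "E (Poly_Mapping.single z 1) = A z"
      unfolding E_def using sumset_eval_single[OF fin, of z A 1] Z z
      by (auto simp: nfold_sumset_def)
    then show ?thesis
      using A[OF z] sumset_eval_superset[OF fin V' q[OF z]] by (simp add: E_def)
  qed
  let ?G = "(\<lambda>z. Var z - Mon (q z) :: ('v, 'k) poly) ` Z"
  have G: "?G \<subseteq> polys_in W"
    using Z qW by (auto simp: Var_def intro!: polys_in_diff polys_in_Mon exponents_in_single)
  have I'W: "sumset_ideal V' A \<subseteq> (polys_in W :: ('v, 'k) poly set)"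
    using polys_in_mono[OF V'] by (auto simp: ker[OF V'])
  have I: "ideal ?I ?R" and J: "ideal ?J ?R"
    using I'W G by (auto intro: ideal_genideal_poly_ring)
  let ?K = "{f \<in> polys_in W. pushforward E f = (0 :: _ \<Rightarrow>\<^sub>0 'k)}"
  have K: "ideal ?K ?R"
    by (rule ideal_pushforward_kernel[OF E_add])
  have "?I \<subseteq> ?K"
    using I'W by (intro genideal_poly_ring_minimal[OF I'W K]) (auto simp: ker[OF V'])
  moreover have JK: "?J \<subseteq> ?K"
    using G E_q
    by (intro genideal_poly_ring_minimal[OF G K])
      (auto simp: pushforward_diff pushforward_Mon Var_def)
  ultimately have "?I <+>\<^bsub>?R\<^esub> ?J \<subseteq> ?K"
    using poly_ring_ideal_add[OF K] by (fastforce simp: set_add_def' poly_ring_def)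
  then have sup: "(?I <+>\<^bsub>?R\<^esub> ?J) \<inter> polys_in V \<subseteq> sumset_ideal V A"
    by (auto simp: ker[OF V])
  \<comment> \<open>\<open>T\<close> relates an exponent vector to those over \<open>V'\<close> that
    are congruent to it modulo the substitution relations. Only the existence of a partner matters,
    so no explicit substitution is constructed.\<close>
  define T where "T = {(e, e'). e' \<in> exponents_in V' \<and> (Mon e - Mon e' :: ('v, 'k) poly) \<in> ?J}"
  have T_add: "(d + e, d' + e') \<in> T"
    if T: "(d, d') \<in> T" "(e, e') \<in> T" and d: "d \<in> exponents_in W" for d d' e e'
  proof -
    have e': "e' \<in> exponents_in W"
      using T(2) V' by (auto simp: T_def exponents_in_def)
    \<comment> \<open>Congruences multiply: the difference is split at the intermediate product
      \<open>Mon d * Mon e'\<close>. The multipliers \<open>Mon d\<close> and \<open>Mon e'\<close>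
      must themselves lie in the ring over \<open>W\<close>.\<close>
    have "(Mon (d + e) - Mon (d' + e') :: ('v, 'k) poly) =
        Mon d * (Mon e - Mon e') + Mon e' * (Mon d - Mon d')"
      by (simp add: Mon_add algebra_simps)
    also have "\<dots> \<in> ?J"
      using T d e' by (intro poly_ring_ideal_add[OF J] poly_ring_ideal_mult[OF J] polys_in_Mon)
        (auto simp: T_def)
    finally show ?thesis
      using T by (auto simp: T_def exponents_in_add)
  qed
  have T_0: "(0, 0) \<in> T"
    by (simp add: T_def poly_ring_ideal_0[OF J])
  have T_1: "\<exists>e'. (Poly_Mapping.single v 1, e') \<in> T" if "v \<in> W" for v
  proof (cases "v \<in> V'")
    case True
    then have "(Poly_Mapping.single v 1, Poly_Mapping.single v 1) \<in> T"
      by (simp add: T_def poly_ring_ideal_0[OF J] exponents_in_single)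
    then show ?thesis ..
  next
    case False
    with that have "v \<in> Z"
      by (simp add: W_def)
    then have "(Poly_Mapping.single v 1, q v) \<in> T"
      using subset_genideal_poly_ring[OF G] q by (auto simp: T_def Var_def)
    then show ?thesis ..
  qed
  have T_single: "\<exists>e'. (Poly_Mapping.single v j, e') \<in> T" if v: "v \<in> W" for v j
  proof (induction j)
    case 0
    show ?case
      using T_0 by auto
  next
    case (Suc j)
    then obtain d' e' where "(Poly_Mapping.single v j, d') \<in> T" "(Poly_Mapping.single v 1, e') \<in> T"
      using T_1[OF v] by blast
    then have "(Poly_Mapping.single v j + Poly_Mapping.single v 1, d' + e') \<in> T"
      by (rule T_add) (rule exponents_in_single[OF v])
    then show ?case
      by (auto simp flip: single_add)
  qed
  have "e \<in> exponents_in W \<longrightarrow> (\<exists>e'. (e, e') \<in> T)" for e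
  proof (induction e rule: poly_mapping_single_add_induct)
    case (single v j)
    \<comment> \<open>If \<open>j = 0\<close>, the vector is zero and \<open>v\<close> may lie
      outside \<open>W\<close>; this case is covered by \<open>T_0\<close>.\<close>
    then show ?case
      using T_single[of v j] T_0 by (cases "j = 0") (auto simp: exponents_in_def)
  next
    case (add d e)
    \<comment> \<open>Natural exponents cannot cancel, so if the sum involves only variables in
      \<open>W\<close>, then so do both summands and the induction hypotheses apply.\<close>
    have "Poly_Mapping.keys (d + e) = Poly_Mapping.keys d \<union> Poly_Mapping.keys e"
      by (auto simp: in_keys_iff lookup_add)
    then show ?case
      using add T_add unfolding exponents_in_def by blast
  qed (use T_0 in blast)
  then obtain \<phi> where \<phi>: "(e, \<phi> e) \<in> T" if "e \<in> exponents_in W" for e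
    by metis
  have "f \<in> ?I <+>\<^bsub>?R\<^esub> ?J" if f: "f \<in> sumset_ideal V A" for f :: "('v, 'k) poly"
  proof -
    have fW: "f \<in> polys_in W" and Ef: "pushforward E f = 0"
      using f polys_in_mono[OF V] by (auto simp: ker[OF V])
    define g where "g = pushforward \<phi> f"
    have e_T: "(e, \<phi> e) \<in> T" if "e \<in> Poly_Mapping.keys f" for e
      using \<phi> polys_in_keys[OF fW that] by blast
    let ?c = "Poly_Mapping.lookup f"
    have "f - g = (\<Sum>e\<in>Poly_Mapping.keys f. Poly_Mapping.single 0 (?c e) * (Mon e - Mon (\<phi> e)))"
      by (simp add: g_def diff_pushforward Mon_def mult_single right_diff_distrib)
    also have "\<dots> \<in> ?J"
      using e_T by (intro poly_ring_ideal_sum[OF J] poly_ring_ideal_mult[OF J] polys_in_single)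
        (auto simp: T_def)
    finally have fg: "f - g \<in> ?J" .
    \<comment> \<open>Since \<open>?J\<close> lies in the kernel, \<open>g\<close> inherits
      membership from \<open>f\<close>; being a polynomial over \<open>V'\<close>, it then belongs
      to the sumset ideal of \<open>V'\<close>.\<close>
    then have "pushforward E g = 0"
      using JK Ef by (auto simp: pushforward_diff)
    moreover have "g \<in> polys_in V'"
      unfolding g_def using e_T by (intro polys_in_pushforward) (auto simp: T_def)
    ultimately have "g \<in> ?I"
      using subset_genideal_poly_ring[OF I'W] by (auto simp: ker[OF V'])
    with fg have "\<exists>g\<in>?I. \<exists>h\<in>?J. f = g + h"
      by (intro bexI[of _ g] bexI[of _ "f - g"]) simp_all
    then show ?thesis
      by (auto simp: set_add_def' poly_ring_def)
  qed
  then show ?thesis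
    using sup by (auto simp: ker[OF V])
qed

section \<open>Grids as sums of two-element sets, and the elimination formula for them\<close>

lemma nfold_sumset_pair: "nfold_sumset j {0, c} = {i * c | i. i \<in> {0..j}}"
proof (induction j)
  case (Suc j)
  have "{i * c | i. i \<in> {0..j}} + {0, c} = {i * c | i. i \<in> {0..Suc j}}" (is "?L = ?R")
  proof
    show "?L \<subseteq> ?R"
    proof
      fix x assume "x \<in> ?L"
      then obtain i where "i \<le> j" "x = i * c \<or> x = Suc i * c"
        by (auto simp: set_plus_def add.commute)
      then have "i \<in> {0..Suc j}" "Suc i \<in> {0..Suc j}" "x = i * c \<or> x = Suc i * c"
        by auto
      then show "x \<in> ?R"
        by blast
    qed
    show "?R \<subseteq> ?L"
    proof
      fix x assume "x \<in> ?R"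
      then obtain i where i: "i \<le> Suc j" "x = i * c"
        by auto
      show "x \<in> ?L"
      \<comment> \<open>Multiples up to \<open>j * c\<close> are reached by adding 0; the one new
        multiple, \<open>Suc j * c\<close>, is \<open>j * c\<close> plus \<open>c\<close>.\<close>
      proof (cases "i \<le> j")
        case True
        then show ?thesis
          using i set_plus_intro[of "i * c" "{i * c | i. i \<in> {0..j}}" 0 "{0, c}"] by auto
      next
        case False
        then show ?thesis
          using i set_plus_intro[of "j * c" "{i * c | i. i \<in> {0..j}}" c "{0, c}"]
          by (auto simp: le_Suc_eq add.commute)
      qed
    qed
  qed
  with Suc show ?case
    by (simp add: nfold_sumset_Suc)
qed (simp add: nfold_sumset_0)

text \<open>The two coefficients of a grid point vary independently, one counting the copies that
  contribute \<open>k * \<aa>\<close> and the other those that contribute \<open>k * \<bb>\<close>.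
  This is what makes each grid the value of a monomial in \<open>X\<close> and
  \<open>Y\<close>.\<close>

lemma grid_eq_nfold_sumset:
  "grid k \<aa> \<bb> n m = nfold_sumset n {0, k * \<aa>} + nfold_sumset m {0, k * \<bb>}"
  unfolding grid_def nfold_sumset_pair set_plus_def by (auto simp: mult.assoc)

theorem theorem11:
  fixes \<aa> \<bb> k p s t :: nat
    and n m a b :: "nat \<Rightarrow> nat"
  assumes "0 < \<aa>" and "\<aa> < \<bb>" and "coprime \<aa> \<bb>" and "0 < k"
    and "\<And>i. i \<in> {1..t} \<Longrightarrow> n i + m i > 0"
    and "s \<le> t"
    and "\<And>j. j \<in> {1..p} \<Longrightarrow> b j > 0"
    and "\<And>i. i \<in> {1..s} \<Longrightarrow> a i > 0"
  defines "A \<equiv> generator k \<aa> \<bb> b a s n m"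
    and "V \<equiv> Xs ` {1..p} \<union> Zs ` {1..t}"
    and "V' \<equiv> Xs ` {1..p} \<union> Ws ` {1..s} \<union> {X, Y}"
    and "W \<equiv> Xs ` {1..p} \<union> Ws ` {1..s} \<union> {X, Y} \<union> Zs ` {1..t}"
  shows "(sumset_ideal V A :: (var, 'k::field) poly set) =
    (Idl\<^bsub>poly_ring W\<^esub> (sumset_ideal V' A) <+>\<^bsub>poly_ring W\<^esub>
     Idl\<^bsub>poly_ring W\<^esub>
       ({Var (Zs i) - Var (Ws i) * Var X ^ n i * Var Y ^ m i | i. i \<in> {1..s}} \<union>
        {Var (Zs i) - Var X ^ n i * Var Y ^ m i | i. i \<in> {s+1..t}}))
    \<inter> polys_in V"
proof -
  \<comment> \<open>The exponent of the monomial that replaces \<open>Zs i\<close>; the factor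
    \<open>Ws i\<close> appears exactly for the translated grids and accounts for the shift by
    \<open>a i\<close>.\<close>
  define q where "q v = (case v of
      Zs i \<Rightarrow> (if i \<le> s then Poly_Mapping.single (Ws i) 1 else 0) +
        Poly_Mapping.single X (n i) + Poly_Mapping.single Y (m i)
    | _ \<Rightarrow> 0)" for v
  have fin: "finite V'"
    by (simp add: V'_def)
  have q: "q z \<in> exponents_in V'" if "z \<in> Zs ` {1..t}" for z
    using that by (auto simp: q_def V'_def intro!: exponents_in_add exponents_in_single)
  have A: "A z = sumset_eval V' A (q z)" if z: "z \<in> Zs ` {1..t}" for z
  proof -
    obtain i where i: "z = Zs i" "1 \<le> i"
      using z by auto
    \<comment> \<open>Indices start at 1, so \<open>1 \<le> i\<close> is needed besides
      \<open>i \<le> s\<close>.\<close>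
    have "Ws i \<in> V'" if "i \<le> s"
      using that i by (auto simp: V'_def)
    moreover have "X \<in> V'" "Y \<in> V'"
      by (auto simp: V'_def)
    ultimately show ?thesis
      using i by (simp add: q_def sumset_eval_add sumset_eval_single[OF fin] A_def
          grid_eq_nfold_sumset nfold_sumset_def add.assoc)
  qed
  have Mon_q: "Mon (q (Zs i)) =
      (if i \<le> s then Var (Ws i) * Var X ^ n i * Var Y ^ m i else Var X ^ n i * Var Y ^ m i)" for i
    by (simp add: q_def Mon_add Var_power) (simp add: Var_def)
  \<comment> \<open>The relations for translated and untranslated grids are merged into one family
    indexed by \<open>Zs\<close>, the form the elimination lemma expects; \<open>s \<le> t\<close>
    keeps the first family within range.\<close>
  have "{Var (Zs i) - Var (Ws i) * Var X ^ n i * Var Y ^ m i | i. i \<in> {1..s}} \<union>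
      {Var (Zs i) - Var X ^ n i * Var Y ^ m i | i. i \<in> {s+1..t}} =
      ((\<lambda>z. Var z - Mon (q z)) ` Zs ` {1..t} :: (var, 'k) poly set)" (is "?L1 \<union> ?L2 = ?R")
  proof
    show "?L1 \<union> ?L2 \<subseteq> ?R"
    proof
      fix f assume "f \<in> ?L1 \<union> ?L2"
      then consider i where "i \<in> {1..s}" "f = Var (Zs i) - Var (Ws i) * Var X ^ n i * Var Y ^ m i"
        | i where "i \<in> {s+1..t}" "f = Var (Zs i) - Var X ^ n i * Var Y ^ m i"
        by blast
      then show "f \<in> ?R"
      proof cases
        case (1 i)
        then have "f = Var (Zs i) - Mon (q (Zs i))" "i \<in> {1..t}"
          using \<open>s \<le> t\<close> by (simp_all add: Mon_q)
        then show ?thesis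
          by blast
      next
        case (2 i)
        then have "f = Var (Zs i) - Mon (q (Zs i))" "i \<in> {1..t}"
          by (simp_all add: Mon_q)
        then show ?thesis
          by blast
      qed
    qed
    show "?R \<subseteq> ?L1 \<union> ?L2"
      by (auto simp: image_image Mon_q)
  qed
  moreover have "W = V' \<union> Zs ` {1..t}"
    by (simp add: W_def V'_def)
  moreover have "V \<subseteq> V' \<union> Zs ` {1..t}"
    by (auto simp: V_def V'_def)
  ultimately show ?thesis
    using sumset_ideal_elimination[of V' "Zs ` {1..t}" V q A] fin q A by simp
qed

end
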